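(* Define $f_1=0$, $f_2=1$, $f_3=2$ and $f_n=f_{n-1}+f_{n-3}+1$ for $n\ge 4$. For every $n\ge 3$, a path of order $n$ has exactly $f_{n-2}+2$ locally minimal defensive alliances, and $f_{n-2}+2\in\mathcal{O}(1.4656^n)$.
   Context: Graphs are finite, simple and undirected. For $G=(V,E)$, $X\subseteq V$ and $v\in V$, $\deg_X(v)$ is the number of neighbors of $v$ in $X$, and $\overline{X}=V\setminus X$. A set $A\subseteq V$ is a defensive alliance if $\deg_A(v)+1\ge \deg_{\overline{A}}(v)$ for every $v\in A$. A non-empty defensive alliance $A$ is locally minimal if for no $v\in A$ the set $A\setminus\{v\}$ is a non-empty defensive alliance. The order of a graph is its number of vertices. *)

theory Defs
  imports Complex_Main "HOL-Library.Landau_Symbols"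
begin

text \<open>A graph is a vertex set \<^term>\<open>V\<close> together with a set \<^term>\<open>E\<close> of two-element subsets of \<^term>\<open>V\<close>.\<close>

definition finite_simple_graph :: "'a set \<Rightarrow> 'a set set \<Rightarrow> bool" where
  "finite_simple_graph V E \<longleftrightarrow> finite V \<and> (\<forall>e\<in>E. e \<subseteq> V \<and> card e = 2)"

definition deg_in :: "'a set set \<Rightarrow> 'a set \<Rightarrow> 'a \<Rightarrow> nat" where
  "deg_in E X v = card {u \<in> X. {u, v} \<in> E}"

definition defensive_alliance :: "'a set \<Rightarrow> 'a set set \<Rightarrow> 'a set \<Rightarrow> bool" where
  "defensive_alliance V E A \<longleftrightarrow>
     A \<subseteq> V \<and> (\<forall>v\<in>A. deg_in E A v + 1 \<ge> deg_in E (V - A) v)"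

definition locally_minimal_defensive_alliance ::
    "'a set \<Rightarrow> 'a set set \<Rightarrow> 'a set \<Rightarrow> bool" where
  "locally_minimal_defensive_alliance V E A \<longleftrightarrow>
     A \<noteq> {} \<and> defensive_alliance V E A \<and>
     \<not> (\<exists>v\<in>A. A - {v} \<noteq> {} \<and> defensive_alliance V E (A - {v}))"

text \<open>The list \<^term>\<open>vs\<close> enumerates the vertices in the order in which they occur along the path.\<close>

definition path_graph :: "'a set \<Rightarrow> 'a set set \<Rightarrow> bool" where
  "path_graph V E \<longleftrightarrow>
     (\<exists>vs. vs \<noteq> [] \<and> distinct vs \<and> V = set vs \<and>
           E = {{vs ! i, vs ! Suc i} | i. Suc i < length vs})"

text \<open>The sequence is indexed from 1; the value at 0 is a dummy.\<close>

fun f_seq :: "nat \<Rightarrow> nat" where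
  "f_seq 0 = 0"
| "f_seq (Suc 0) = 0"
| "f_seq (Suc (Suc 0)) = 1"
| "f_seq (Suc (Suc (Suc 0))) = 2"
| "f_seq (Suc (Suc (Suc (Suc n)))) = f_seq (Suc (Suc (Suc n))) + f_seq (Suc n) + 1"

lemma f_seq_rec: "n \<ge> 4 \<Longrightarrow> f_seq n = f_seq (n - 1) + f_seq (n - 3) + 1"
  by (induction n rule: f_seq.induct) simp_all

lemma path_graph_imp_finite_simple_graph:
  assumes "path_graph V E"
  shows "finite_simple_graph V E"
proof -
  obtain vs where vs: "distinct vs" "V = set vs"
      "E = {{vs ! i, vs ! Suc i} | i. Suc i < length vs}"
    using assms by (auto simp: path_graph_def)
  have "{vs ! i, vs ! Suc i} \<subseteq> V \<and> card {vs ! i, vs ! Suc i} = 2" if "Suc i < length vs" for i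
    using that vs by (simp add: nth_eq_iff_index_eq)
  then show ?thesis
    using vs by (auto simp: finite_simple_graph_def)
qed

end

theory Submission
  imports Defs
begin

text \<open>Number the path \<open>0, \<dots>, n - 1\<close>. The condition is void at an endpoint, and at an interior vertex
  of an alliance it says that some neighbour lies in the alliance. Apart from the two endpoint
  singletons, locally minimal alliances therefore avoid the endpoints and induce components of size
  exactly two, since the end of a longer component could be removed. Such sets (the empty one included)
  are counted by looking at the last vertex: it is either absent, or it forms a component with its
  predecessor and the vertex before that is absent. Finally \<open>c = 1.4656\<close> satisfies
  \<open>c\<^sup>2 + 1 \<le> c\<^sup>3\<close>, which gives the growth bound.\<close>

section \<open>Reduction from vertices of a path to their indices\<close>

definition path_edges :: "'a list \<Rightarrow> 'a set set" where
  "path_edges vs = {{vs ! i, vs ! Suc i} | i. Suc i < length vs}"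

lemma nth_edge_path_edges_iff:
  assumes "distinct vs" "i < length vs" "j < length vs"
  shows "{vs ! j, vs ! i} \<in> path_edges vs \<longleftrightarrow> j = Suc i \<or> i = Suc j"
proof
  assume "{vs ! j, vs ! i} \<in> path_edges vs"
  then obtain k where "{vs ! j, vs ! i} = {vs ! k, vs ! Suc k}" "Suc k < length vs"
    by (auto simp: path_edges_def)
  then show "j = Suc i \<or> i = Suc j"
    using assms by (auto simp: doubleton_eq_iff nth_eq_iff_index_eq)
next
  assume "j = Suc i \<or> i = Suc j"
  then show "{vs ! j, vs ! i} \<in> path_edges vs"
    using assms by (auto simp: path_edges_def insert_commute)
qed

lemma deg_in_path:
  assumes "distinct vs" "S \<subseteq> {..<length vs}" "i < length vs"
  shows "deg_in (path_edges vs) ((!) vs ` S) (vs ! i) = card {j \<in> S. j = Suc i \<or> i = Suc j}"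
proof -
  have "{vs ! j, vs ! i} \<in> path_edges vs \<longleftrightarrow> j = Suc i \<or> i = Suc j" if "j \<in> S" for j
    using assms that by (intro nth_edge_path_edges_iff) auto
  then have "{u \<in> (!) vs ` S. {u, vs ! i} \<in> path_edges vs} = (!) vs ` {j \<in> S. j = Suc i \<or> i = Suc j}"
    by auto
  moreover have "inj_on ((!) vs) {j \<in> S. j = Suc i \<or> i = Suc j}"
    using assms by (auto simp: inj_on_def nth_eq_iff_index_eq)
  ultimately show ?thesis
    by (simp add: deg_in_def card_image)
qed

text \<open>At \<open>i = 0\<close> the truncated \<open>i - 1\<close> would be \<open>i\<close>
  itself, but the first disjunct already accepts that index.\<close>

definition index_alliance :: "nat \<Rightarrow> nat set \<Rightarrow> bool" where
  "index_alliance n S \<longleftrightarrow> (\<forall>i\<in>S. i = 0 \<or> Suc i = n \<or> i - 1 \<in> S \<or> Suc i \<in> S)"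

text \<open>An endpoint has at most one neighbour, which the \<open>+ 1\<close> in the alliance
  condition absorbs. An interior vertex has two, and the inequality fails exactly when both lie
  outside the set.\<close>

lemma defensive_alliance_path_iff:
  assumes "distinct vs" "S \<subseteq> {..<length vs}"
  shows "defensive_alliance (set vs) (path_edges vs) ((!) vs ` S) \<longleftrightarrow> index_alliance (length vs) S"
proof -
  let ?n = "length vs"
  have compl: "set vs - (!) vs ` S = (!) vs ` ({..<?n} - S)"
    using assms by (auto simp: set_conv_nth nth_eq_iff_index_eq subset_iff)
  have "card {j \<in> {..<?n} - S. j = Suc i \<or> i = Suc j} \<le> card {j \<in> S. j = Suc i \<or> i = Suc j} + 1
      \<longleftrightarrow> i = 0 \<or> Suc i = ?n \<or> i - 1 \<in> S \<or> Suc i \<in> S" if "i \<in> S" for i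
  proof (cases "i = 0 \<or> Suc i = ?n")
    case True
    \<comment> \<open>The singleton holds the only index that can be adjacent to an
      endpoint.\<close>
    then have "{j \<in> {..<?n} - S. j = Suc i \<or> i = Suc j} \<subseteq> {if i = 0 then 1 else i - 1}"
      by auto
    then have "card {j \<in> {..<?n} - S. j = Suc i \<or> i = Suc j} \<le> 1"
      using card_mono[of "{if i = 0 then 1 else i - 1}"] by simp
    with True show ?thesis
      by auto
  next
    case False
    with that assms(2) obtain k where k: "i = Suc k" "Suc (Suc k) < ?n"
      by (metis Suc_lessI lessThan_iff not0_implies_Suc subsetD)
    have nbs: "{j \<in> S. j = Suc i \<or> i = Suc j} = {k, Suc (Suc k)} \<inter> S"
      using k by auto
    have nbs_compl: "{j \<in> {..<?n} - S. j = Suc i \<or> i = Suc j} = {k, Suc (Suc k)} - S"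
      using k by auto
    show ?thesis
      unfolding nbs nbs_compl
      using k by (cases "k \<in> S"; cases "Suc (Suc k) \<in> S") (simp_all add: insert_Diff_if Int_insert_left)
  qed
  moreover have "(!) vs ` S \<subseteq> set vs"
    using assms(2) by auto
  ultimately show ?thesis
    using assms deg_in_path[OF assms] deg_in_path[OF assms(1), of "{..<?n} - S"]
    unfolding defensive_alliance_def index_alliance_def compl by (simp add: subset_iff)
qed

lemma index_allianceD:
  "index_alliance n S \<Longrightarrow> i \<in> S \<Longrightarrow> i = 0 \<or> Suc i = n \<or> i - 1 \<in> S \<or> Suc i \<in> S"
  by (simp add: index_alliance_def)

definition index_minimal :: "nat \<Rightarrow> nat set \<Rightarrow> bool" where
  "index_minimal n S \<longleftrightarrow> S \<noteq> {} \<and> index_alliance n S \<and>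
     (\<forall>i\<in>S. S - {i} \<noteq> {} \<longrightarrow> \<not> index_alliance n (S - {i}))"

lemma locally_minimal_path_iff:
  assumes "distinct vs" "S \<subseteq> {..<length vs}"
  shows "locally_minimal_defensive_alliance (set vs) (path_edges vs) ((!) vs ` S)
    \<longleftrightarrow> index_minimal (length vs) S"
proof -
  let ?D = "defensive_alliance (set vs) (path_edges vs)"
  have "(!) vs ` S - {vs ! i} \<noteq> {} \<and> ?D ((!) vs ` S - {vs ! i})
      \<longleftrightarrow> S - {i} \<noteq> {} \<and> index_alliance (length vs) (S - {i})" if "i \<in> S" for i
  proof -
    have "(!) vs ` S - {vs ! i} = (!) vs ` (S - {i})"
      using assms that by (auto simp: nth_eq_iff_index_eq subset_iff)
    moreover have "S - {i} \<subseteq> {..<length vs}"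
      using assms(2) by auto
    ultimately show ?thesis
      using assms(1) by (simp only: defensive_alliance_path_iff image_is_empty)
  qed
  then have "(\<exists>v\<in>(!) vs ` S. (!) vs ` S - {v} \<noteq> {} \<and> ?D ((!) vs ` S - {v}))
      \<longleftrightarrow> (\<exists>i\<in>S. S - {i} \<noteq> {} \<and> index_alliance (length vs) (S - {i}))"
    by blast
  then show ?thesis
    unfolding locally_minimal_defensive_alliance_def index_minimal_def
      defensive_alliance_path_iff[OF assms] image_is_empty by blast
qed

text \<open>Taking images under \<open>(!) vs\<close> is a bijection from index sets below
  \<open>length vs\<close> to vertex sets, and it preserves local minimality.\<close>

lemma card_locally_minimal_path:
  assumes "distinct vs"
  shows "card {A. locally_minimal_defensive_alliance (set vs) (path_edges vs) A}
    = card {S. S \<subseteq> {..<length vs} \<and> index_minimal (length vs) S}"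
proof -
  have img: "set vs = (!) vs ` {..<length vs}"
    by (auto simp: set_conv_nth)
  have "A \<in> (`) ((!) vs) ` {S. S \<subseteq> {..<length vs} \<and> index_minimal (length vs) S}"
    if A: "locally_minimal_defensive_alliance (set vs) (path_edges vs) A" for A
  proof -
    from A have "A \<subseteq> set vs"
      by (simp add: locally_minimal_defensive_alliance_def defensive_alliance_def)
    then obtain S where "S \<subseteq> {..<length vs}" "A = (!) vs ` S"
      unfolding img by (auto simp: subset_image_iff)
    with A assms show ?thesis
      by (auto simp: locally_minimal_path_iff)
  qed
  then have "{A. locally_minimal_defensive_alliance (set vs) (path_edges vs) A}
      = (`) ((!) vs) ` {S. S \<subseteq> {..<length vs} \<and> index_minimal (length vs) S}"
    using assms by (auto simp: locally_minimal_path_iff)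
  moreover have "inj_on ((`) ((!) vs)) {S. S \<subseteq> {..<length vs} \<and> index_minimal (length vs) S}"
    by (rule inj_on_subset[OF inj_on_image_Pow[of _ "{..<length vs}"]])
      (use assms in \<open>auto simp: inj_on_def nth_eq_iff_index_eq\<close>)
  ultimately show ?thesis
    by (simp add: card_image)
qed

section \<open>Classification of the locally minimal index sets\<close>

text \<open>The truncated predecessor is harmless because the sets never contain 0.\<close>

definition domino_sets :: "nat \<Rightarrow> nat set set" where
  "domino_sets m = {S. S \<subseteq> {1..m} \<and> (\<forall>i\<in>S. (Suc i \<in> S) \<noteq> (i - 1 \<in> S))}"

text \<open>Any further element makes some vertex removable. If \<open>1\<close> is in
  \<open>S\<close> and \<open>2\<close> is not, remove \<open>1\<close>: only \<open>0\<close> is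
  adjacent to it, and \<open>0\<close> needs no support. Otherwise remove \<open>0\<close>: only
  \<open>1\<close> could rely on it, and if present, \<open>1\<close> still has
  \<open>2\<close>.\<close>

lemma index_minimal_zero_mem:
  assumes "index_minimal n S" "0 \<in> S"
  shows "S = {0}"
proof (rule ccontr)
  assume "S \<noteq> {0}"
  then have ne: "S - {0} \<noteq> {}"
    using assms(2) by auto
  have al: "index_alliance n S"
    and min: "\<And>i. i \<in> S \<Longrightarrow> S - {i} \<noteq> {} \<Longrightarrow> \<not> index_alliance n (S - {i})"
    using assms(1) by (auto simp: index_minimal_def)
  have cond: "i = 0 \<or> Suc i = n \<or> i - 1 \<in> S \<or> Suc i \<in> S" if "i \<in> S" for i
    using al that by (auto simp: index_alliance_def)
  show False
  proof (cases "1 \<in> S \<and> 2 \<notin> S")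
    case True
    have "index_alliance n (S - {1})"
      unfolding index_alliance_def
    proof
      fix i assume "i \<in> S - {1}"
      with True have "i \<in> S" "i \<noteq> 1" "i \<noteq> 2" by auto
      with cond[of i] show "i = 0 \<or> Suc i = n \<or> i - 1 \<in> S - {1} \<or> Suc i \<in> S - {1}"
        by auto
    qed
    moreover have "0 \<in> S - {1}"
      using assms(2) by simp
    ultimately show False
      using min[of 1] True by blast
  next
    case False
    have "index_alliance n (S - {0})"
      unfolding index_alliance_def
    proof
      fix i assume "i \<in> S - {0}"
      then have i: "i \<in> S" "i \<noteq> 0" by auto
      show "i = 0 \<or> Suc i = n \<or> i - 1 \<in> S - {0} \<or> Suc i \<in> S - {0}"
      proof (cases "i = 1")
        case True
        with False i show ?thesis by (simp add: numeral_2_eq_2)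
      next
        case False
        with cond[of i] i show ?thesis by auto
      qed
    qed
    with min[OF assms(2) ne] show False ..
  qed
qed

text \<open>Mirror image of \<open>index_minimal_zero_mem\<close>: either the last vertex or its
  predecessor can be removed.\<close>

lemma index_minimal_last_mem:
  assumes "index_minimal n S" "n - 1 \<in> S" "3 \<le> n" "S \<subseteq> {..<n}"
  shows "S = {n - 1}"
proof (rule ccontr)
  assume "S \<noteq> {n - 1}"
  then have ne: "S - {n - 1} \<noteq> {}"
    using assms(2) by auto
  have al: "index_alliance n S"
    and min: "\<And>i. i \<in> S \<Longrightarrow> S - {i} \<noteq> {} \<Longrightarrow> \<not> index_alliance n (S - {i})"
    using assms(1) by (auto simp: index_minimal_def)
  \<comment> \<open>The last three indices become \<open>k\<close>, \<open>Suc k\<close> and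
    \<open>Suc (Suc k)\<close>, which avoids truncated subtraction.\<close>
  obtain k where k: "n = Suc (Suc (Suc k))"
    using assms(3) by (metis Suc_le_D numeral_3_eq_3 Suc_le_mono)
  show False
  proof (cases "Suc k \<in> S \<and> k \<notin> S")
    case True
    have "index_alliance n (S - {Suc k})"
      unfolding index_alliance_def
    proof
      fix i assume i: "i \<in> S - {Suc k}"
      then have "i = 0 \<or> Suc i = n \<or> i - 1 \<in> S \<or> Suc i \<in> S"
        using al by (auto simp: index_alliance_def)
      moreover have "i \<noteq> k" "i < n" using True i assms(4) by auto
      ultimately show "i = 0 \<or> Suc i = n \<or> i - 1 \<in> S - {Suc k} \<or> Suc i \<in> S - {Suc k}"
        using k i by auto
    qed
    moreover have "Suc (Suc k) \<in> S - {Suc k}"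
      using assms(2) k by simp
    ultimately show False
      using min[of "Suc k"] True by blast
  next
    case False
    have "index_alliance n (S - {Suc (Suc k)})"
      unfolding index_alliance_def
    proof
      fix i assume i: "i \<in> S - {Suc (Suc k)}"
      then have "i = 0 \<or> Suc i = n \<or> i - 1 \<in> S \<or> Suc i \<in> S"
        using al by (auto simp: index_alliance_def)
      moreover have "i < n" using i assms(4) by auto
      moreover have "i = Suc k \<Longrightarrow> k \<in> S" using i False by auto
      ultimately show "i = 0 \<or> Suc i = n \<or> i - 1 \<in> S - {Suc (Suc k)} \<or> Suc i \<in> S - {Suc (Suc k)}"
        using k i by auto
    qed
    moreover have "n - 1 = Suc (Suc k)"
      using k by simp
    ultimately show False
      using min[OF assms(2) ne] by simp
  qed
qed

text \<open>Away from the endpoints the alliance condition gives each member at least one neighbour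
  in \<open>S\<close>, and minimality gives at most one. So the components are pairs of consecutive
  indices.\<close>

lemma index_minimal_interior:
  assumes "index_minimal n S" "0 \<notin> S" "n - 1 \<notin> S" "S \<subseteq> {..<n}"
  shows "S \<in> domino_sets (n - 2)"
proof -
  have al: "index_alliance n S"
    and min: "\<And>i. i \<in> S \<Longrightarrow> S - {i} \<noteq> {} \<Longrightarrow> \<not> index_alliance n (S - {i})"
    using assms(1) by (auto simp: index_minimal_def)
  have bounds: "1 \<le> i \<and> i \<le> n - 2" if "i \<in> S" for i
  proof -
    have "i \<noteq> 0" "i \<noteq> n - 1" "i < n"
      using that assms(2-4) by (metis, metis, blast)
    then show ?thesis by linarith
  qed
  have some: "i - 1 \<in> S \<or> Suc i \<in> S" if "i \<in> S" for i
    using al that bounds[OF that] by (force simp: index_alliance_def)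
  \<comment> \<open>Strong induction finds the left end of a long component. If
    \<open>i - 1\<close>, \<open>i\<close>, \<open>Suc i\<close> all lie in \<open>S\<close>, the
    hypothesis at \<open>i - 1\<close> excludes \<open>i - 2\<close>. Then \<open>i - 1\<close> can
    be removed, since its only neighbour in \<open>S\<close> is \<open>i\<close>, which keeps
    \<open>Suc i\<close>.\<close>
  have not_both: "\<not> (i \<in> S \<and> i - 1 \<in> S \<and> Suc i \<in> S)" for i
  proof (induction i rule: less_induct)
    case (less i)
    show ?case
    proof
      assume i: "i \<in> S \<and> i - 1 \<in> S \<and> Suc i \<in> S"
      then obtain k where k: "i = Suc (Suc k)"
        using bounds[of i] bounds[of "i - 1"] by (cases i; cases "i - 1") auto
      have "k \<notin> S"
        using less[of "Suc k"] i k by auto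
      have "index_alliance n (S - {Suc k})"
        unfolding index_alliance_def
      proof
        fix j assume j: "j \<in> S - {Suc k}"
        show "j = 0 \<or> Suc j = n \<or> j - 1 \<in> S - {Suc k} \<or> Suc j \<in> S - {Suc k}"
        proof (cases "j = i")
          case True
          with i k show ?thesis by auto
        next
          case False
          moreover have "j \<noteq> 0" "j \<noteq> k"
            using j bounds[of j] \<open>k \<notin> S\<close> by auto
          ultimately show ?thesis
            using j k some[of j] by auto
        qed
      qed
      moreover have "i \<in> S - {Suc k}" "Suc k \<in> S"
        using i k by auto
      ultimately show False
        using min[of "Suc k"] by blast
    qed
  qed
  show ?thesis
    using bounds some not_both by (auto simp: domino_sets_def)
qed

lemma index_minimal_singleton_endpoint:
  assumes "i = 0 \<or> Suc i = n"
  shows "index_minimal n {i}"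
  using assms by (auto simp: index_minimal_def index_alliance_def)

text \<open>Removing a member strands its partner: the partner is interior and has no other
  neighbour in \<open>S\<close>.\<close>

lemma index_minimal_domino:
  assumes "S \<in> domino_sets (n - 2)" "S \<noteq> {}"
  shows "index_minimal n S"
proof -
  have S: "1 \<le> i" "i \<le> n - 2" "(Suc i \<in> S) \<noteq> (i - 1 \<in> S)" if "i \<in> S" for i
    using assms(1) that by (auto simp: domino_sets_def)
  have "\<not> index_alliance n (S - {i})" if i: "i \<in> S" for i
  proof (cases "Suc i \<in> S")
    case True
    have "Suc i \<in> S - {i}" "Suc (Suc i) \<noteq> n" "Suc i - 1 \<notin> S - {i}" "Suc (Suc i) \<notin> S - {i}"
      using S[OF True] True i by auto
    then show ?thesis
      using index_allianceD[of n "S - {i}" "Suc i"] by blast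
  next
    case False
    with S[OF i] i have mem: "i - 1 \<in> S"
      by blast
    have "i - 1 \<in> S - {i}" "i - 1 \<noteq> 0" "Suc (i - 1) \<noteq> n" "i - 1 - 1 \<notin> S - {i}" "Suc (i - 1) \<notin> S - {i}"
      using S[OF mem] S[OF i] mem i by auto
    then show ?thesis
      using index_allianceD[of n "S - {i}" "i - 1"] by metis
  qed
  moreover have "index_alliance n S"
    using S by (auto simp: index_alliance_def)
  ultimately show ?thesis
    using assms(2) by (simp add: index_minimal_def)
qed

text \<open>The empty set is a domino set but not a locally minimal alliance, hence the subtraction
  of \<open>{{}}\<close>.\<close>

lemma index_minimal_sets:
  assumes "3 \<le> n"
  shows "{S. S \<subseteq> {..<n} \<and> index_minimal n S} = {{0}, {n - 1}} \<union> (domino_sets (n - 2) - {{}})"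
proof -
  have "S \<noteq> {}" if "index_minimal n S" for S
    using that by (simp add: index_minimal_def)
  then have "S \<in> {{0}, {n - 1}} \<union> (domino_sets (n - 2) - {{}})"
    if "S \<subseteq> {..<n}" "index_minimal n S" for S
    using that assms index_minimal_zero_mem[of n S] index_minimal_last_mem[of n S]
      index_minimal_interior[of n S] by blast
  moreover have "S \<subseteq> {..<n} \<and> index_minimal n S" if "S \<in> domino_sets (n - 2) - {{}}" for S
  proof -
    have "S \<subseteq> {1..n - 2}"
      using that by (auto simp: domino_sets_def)
    also have "\<dots> \<subseteq> {..<n}"
      using assms by auto
    finally show ?thesis
      using that index_minimal_domino[of S n] by blast
  qed
  moreover have "{i} \<subseteq> {..<n} \<and> index_minimal n {i}" if "i = 0 \<or> i = n - 1" for i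
    using that assms index_minimal_singleton_endpoint[of i n] by auto
  ultimately show ?thesis
    by blast
qed

section \<open>Counting domino sets\<close>

lemma finite_domino_sets: "finite (domino_sets m)"
  by (rule finite_subset[of _ "Pow {1..m}"]) (simp_all add: domino_sets_def Pow_def Collect_mono_iff)

lemma domino_sets_rec:
  "domino_sets (m + 3) = domino_sets (m + 2) \<union> (\<lambda>T. T \<union> {m + 2, m + 3}) ` domino_sets m"
proof (intro equalityI subsetI)
  fix S assume S: "S \<in> domino_sets (m + 3)"
  then have sub: "S \<subseteq> {1..m + 3}"
    and dom: "\<And>i. i \<in> S \<Longrightarrow> (Suc i \<in> S) \<noteq> (i - 1 \<in> S)"
    by (auto simp: domino_sets_def)
  show "S \<in> domino_sets (m + 2) \<union> (\<lambda>T. T \<union> {m + 2, m + 3}) ` domino_sets m"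
  proof (cases "m + 3 \<in> S")
    case False
    have "S \<subseteq> {1..m + 2}"
    proof
      fix i assume "i \<in> S"
      then have "i \<in> {1..m + 3}" "i \<noteq> m + 3" using sub False by auto
      then show "i \<in> {1..m + 2}" by auto
    qed
    then show ?thesis
      using dom by (auto simp: domino_sets_def)
  next
    case True
    \<comment> \<open>With \<open>m + 4\<close> out of range, the partner of \<open>m + 3\<close>
      must be \<open>m + 2\<close>; the latter then has its neighbour, which bars
      \<open>m + 1\<close>.\<close>
    moreover have "m + 4 \<notin> S"
      using sub by auto
    ultimately have mem: "m + 2 \<in> S"
      using dom[of "m + 3"] by (simp add: numeral_eq_Suc)
    then have notin: "m + 1 \<notin> S"
      using dom[of "m + 2"] True by (simp add: numeral_eq_Suc)
    define T where "T = S - {m + 2, m + 3}"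
    have T: "i \<in> T \<longleftrightarrow> i \<in> S \<and> i \<le> m" for i
    proof -
      have "i \<in> S \<Longrightarrow> i \<noteq> m + 1 \<and> i \<le> m + 3" using notin sub by auto
      then show ?thesis by (auto simp: T_def)
    qed
    have "T \<in> domino_sets m"
      unfolding domino_sets_def
    proof (intro CollectI conjI ballI)
      show "T \<subseteq> {1..m}" using sub T by auto
      show "(Suc i \<in> T) \<noteq> (i - 1 \<in> T)" if "i \<in> T" for i
      proof -
        \<comment> \<open>Restricting to \<open>T\<close> loses no neighbour: the only candidate
          above \<open>m\<close> is \<open>m + 1\<close>, which is not in \<open>S\<close>.\<close>
        have "Suc i \<in> S \<Longrightarrow> Suc i \<le> m"
          using that T[of i] notin by (metis Suc_eq_plus1 le_antisym not_less_eq_eq)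
        then show ?thesis using dom[of i] that by (auto simp: T)
      qed
    qed
    moreover have "S = T \<union> {m + 2, m + 3}"
      using True mem by (auto simp: T_def)
    ultimately show ?thesis by blast
  qed
next
  fix S assume "S \<in> domino_sets (m + 2) \<union> (\<lambda>T. T \<union> {m + 2, m + 3}) ` domino_sets m"
  then consider "S \<in> domino_sets (m + 2)"
    | T where "T \<in> domino_sets m" "S = T \<union> {m + 2, m + 3}" by auto
  then show "S \<in> domino_sets (m + 3)"
  proof cases
    case 1
    then show ?thesis by (force simp: domino_sets_def)
  next
    case 2
    have bounds: "1 \<le> i \<and> i \<le> m" and dom: "(Suc i \<in> T) \<noteq> (i - 1 \<in> T)" if "i \<in> T" for i
      using 2(1) that by (auto simp: domino_sets_def)
    have S: "j \<in> S \<longleftrightarrow> j \<in> T \<or> j = m + 2 \<or> j = m + 3" for j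
      using 2(2) by auto
    have out: "j \<notin> T" if "m < j" for j
      using bounds[of j] that by auto
    \<comment> \<open>The gap at \<open>m + 1\<close> separates the new pair from \<open>T\<close>,
      so neither affects the neighbours of the other.\<close>
    have "(Suc i \<in> S) \<noteq> (i - 1 \<in> S)" if "i \<in> S" for i
    proof (cases "i \<in> T")
      case True
      then show ?thesis using bounds[OF True] dom[OF True] by (auto simp: S)
    next
      case False
      then have "i = m + 2 \<or> i = m + 3" using that S by auto
      then show ?thesis
        using out by (auto simp: S)
    qed
    moreover have "S \<subseteq> {1..m + 3}"
      using bounds by (force simp: S)
    ultimately show ?thesis by (auto simp: domino_sets_def)
  qed
qed

text \<open>The added pair is disjoint from every set in \<open>domino_sets m\<close>, so adding it
  is injective; the resulting sets contain \<open>m + 3\<close>, so they are not in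
  \<open>domino_sets (m + 2)\<close>. The \<open>Suc\<close> form matches the induction rule of
  \<open>f_seq\<close>.\<close>

lemma card_domino_sets_rec:
  "card (domino_sets (Suc (Suc (Suc m)))) = card (domino_sets (Suc (Suc m))) + card (domino_sets m)"
proof -
  have le: "i \<le> k" if "i \<in> T" "T \<in> domino_sets k" for i k T
    using that by (auto simp: domino_sets_def)
  have "inj_on (\<lambda>T. T \<union> {m + 2, m + 3}) (domino_sets m)"
  proof (rule inj_onI)
    fix T U assume *: "T \<in> domino_sets m" "U \<in> domino_sets m"
      "T \<union> {m + 2, m + 3} = U \<union> {m + 2, m + 3}"
    have "T \<inter> {m + 2, m + 3} = {}" "U \<inter> {m + 2, m + 3} = {}"
      using le[OF _ *(1)] le[OF _ *(2)] by force+
    with *(3) show "T = U" by blast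
  qed
  moreover have "T \<union> {m + 2, m + 3} \<notin> domino_sets (m + 2)" for T
    using le[of "m + 3" "T \<union> {m + 2, m + 3}" "m + 2"] by auto
  then have "domino_sets (m + 2) \<inter> (\<lambda>T. T \<union> {m + 2, m + 3}) ` domino_sets m = {}"
    by blast
  ultimately have "card (domino_sets (m + 3)) = card (domino_sets (m + 2)) + card (domino_sets m)"
    by (simp add: domino_sets_rec card_Un_disjoint finite_domino_sets card_image)
  moreover have "m + 3 = Suc (Suc (Suc m))" "m + 2 = Suc (Suc m)"
    by simp_all
  ultimately show ?thesis
    by (simp only:)
qed

lemma domino_sets_small:
  "domino_sets 0 = {{}}" "domino_sets 1 = {{}}" "domino_sets 2 = {{}, {1, 2}}"
proof -
  show "domino_sets 0 = {{}}"
    by (auto simp: domino_sets_def)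
  have "S = {}" if "S \<in> domino_sets 1" for S
  proof (rule ccontr)
    assume "S \<noteq> {}"
    with that have "S = {1}"
      by (auto simp: domino_sets_def)
    with that show False
      by (simp add: domino_sets_def)
  qed
  then show "domino_sets 1 = {{}}"
    by (auto simp: domino_sets_def)
  have *: "{1..2::nat} = {1, 2}"
    by auto
  have "S = {} \<or> S = {1, 2}" if S: "S \<in> domino_sets 2" for S
  proof -
    have "S \<in> Pow {1, 2}"
      using S unfolding domino_sets_def * by blast
    then have "S = {} \<or> S = {1} \<or> S = {2} \<or> S = {1, 2}"
      by (simp add: Pow_insert) blast
    moreover have "{1} \<notin> domino_sets 2" "{2} \<notin> domino_sets 2"
      by (simp_all add: domino_sets_def)
    ultimately show ?thesis
      using S by metis
  qed
  moreover have "{} \<in> domino_sets 2" "{1, 2} \<in> domino_sets 2"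
    by (simp_all add: domino_sets_def)
  ultimately show "domino_sets 2 = {{}, {1, 2}}"
    by (intro set_eqI) (metis insert_iff empty_iff)
qed

text \<open>Adding 1 to each term makes the recursion of \<open>f_seq\<close> homogeneous, and this
  is the recursion of \<open>card_domino_sets_rec\<close>. The extra 1 accounts for the empty
  set.\<close>

lemma card_domino_sets:
  "m \<ge> 1 \<Longrightarrow> card (domino_sets m) = f_seq m + 1"
proof (induction m rule: f_seq.induct)
  case 2
  show ?case
    using domino_sets_small(2) by simp
next
  case 3
  have "card (domino_sets 2) = 2"
    unfolding domino_sets_small by simp
  then show ?case
    by (simp add: numeral_2_eq_2)
next
  case 4
  \<comment> \<open>Index 3 is a base value of \<open>f_seq\<close>, but the recursion for sets
    already applies there, with \<open>m = 0\<close>.\<close>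
  have "card (domino_sets (Suc (Suc (Suc 0)))) = card (domino_sets 2) + card (domino_sets 0)"
    by (simp only: card_domino_sets_rec numeral_2_eq_2)
  also have "\<dots> = 3"
    unfolding domino_sets_small by simp
  finally show ?case
    by simp
next
  case (5 n)
  then show ?case
    by (simp add: card_domino_sets_rec)
qed simp

lemma card_index_minimal:
  assumes "3 \<le> n"
  shows "card {S. S \<subseteq> {..<n} \<and> index_minimal n S} = f_seq (n - 2) + 2"
proof -
  \<comment> \<open>Members of a domino set lie in \<open>{1..n - 2}\<close>, which omits both
    endpoints.\<close>
  have "{{0}, {n - 1}} \<inter> (domino_sets (n - 2) - {{}}) = {}"
    using assms by (auto simp: domino_sets_def)
  moreover have "card {{0}, {n - 1}} = 2"
    using assms by simp
  moreover have "{} \<in> domino_sets (n - 2)"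
    by (simp add: domino_sets_def)
  ultimately show ?thesis
    using assms
    by (simp add: index_minimal_sets card_Un_disjoint finite_domino_sets card_domino_sets)
qed

section \<open>Exponential growth bound\<close>

text \<open>The shift by 1 again removes the constant from the recursion. The third assumption,
  multiplied by \<open>c ^ Suc n\<close>, is the induction step; together the assumptions also cover
  the initial values 1, 2 and 3.\<close>

lemma f_seq_le_power:
  fixes c :: real
  assumes "1 \<le> c" "2 \<le> c\<^sup>2" "c\<^sup>2 + 1 \<le> c ^ 3"
  shows "real (f_seq m) + 1 \<le> c ^ m"
proof (induction m rule: f_seq.induct)
  case (5 n)
  have "real (f_seq (Suc (Suc (Suc (Suc n))))) + 1 \<le> c ^ Suc (Suc (Suc n)) + c ^ Suc n"
    using 5 by simp
  also have "\<dots> = c ^ Suc n * (c\<^sup>2 + 1)"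
    by (simp add: power2_eq_square algebra_simps)
  also have "\<dots> \<le> c ^ Suc n * c ^ 3"
    using assms by (intro mult_left_mono) simp_all
  also have "\<dots> = c ^ Suc (Suc (Suc (Suc n)))"
    by (simp add: power3_eq_cube)
  finally show ?case .
qed (use assms in \<open>simp_all add: power2_eq_square power3_eq_cube\<close>)

lemma f_seq_bigo: "(\<lambda>n. real (f_seq (n - 2) + 2)) \<in> O(\<lambda>n. 1.4656 ^ n)"
\<comment> \<open>The factor 2 arises from splitting \<open>f_seq (n - 2) + 2\<close> into
  \<open>f_seq (n - 2) + 1\<close> and 1, each at most \<open>1.4656 ^ n\<close>.\<close>
proof (rule bigoI[where c = 2], intro always_eventually allI)
  fix n :: nat
  have "real (f_seq (n - 2)) + 1 \<le> 1.4656 ^ (n - 2)"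
    \<comment> \<open>The number 1.4656 lies just above the real root of
      \<open>x ^ 3 = x ^ 2 + 1\<close>, so the required inequalities are checked
      numerically.\<close>
    by (rule f_seq_le_power) (simp_all add: power2_eq_square power3_eq_cube)
  also have "\<dots> \<le> 1.4656 ^ n"
    by (intro power_increasing) simp_all
  finally have "real (f_seq (n - 2)) + 1 \<le> 1.4656 ^ n" .
  moreover have "(1 :: real) \<le> 1.4656 ^ n"
    by (rule one_le_power) simp
  ultimately show "norm (real (f_seq (n - 2) + 2)) \<le> 2 * norm (1.4656 ^ n :: real)"
    by simp
qed

theorem lemma6:
  shows "(\<forall>n\<ge>3. \<forall>(V :: 'a set) E.
            finite_simple_graph V E \<and> path_graph V E \<and> card V = n \<longrightarrow>
            card {A. locally_minimal_defensive_alliance V E A} = f_seq (n - 2) + 2)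
       \<and> (\<lambda>n. real (f_seq (n - 2) + 2)) \<in> O(\<lambda>n. 1.4656 ^ n)"
proof (intro conjI allI impI)
  fix n :: nat and V :: "'a set" and E
  assume n: "3 \<le> n" and G: "finite_simple_graph V E \<and> path_graph V E \<and> card V = n"
  then obtain vs where "distinct vs" "V = set vs" "E = path_edges vs"
    by (auto simp: path_graph_def path_edges_def)
  with n G show "card {A. locally_minimal_defensive_alliance V E A} = f_seq (n - 2) + 2"
    by (auto simp: card_locally_minimal_path card_index_minimal distinct_card)
qed (rule f_seq_bigo)

end
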